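(* For every positive integer $n$, $$B_n(x)=\sum_{T\in\operatorname{SYT}(n)}\left(\prod_{i=1}^n\sigma_i(T)c_i^{w_i(T)}\right)x^{\frac{1}{2}\left(n-\ell(\lambda(T))\right)},$$ where $c_{2i-1}=4^{i-1}(1+x)$ and $c_{2i}=4^i\sqrt{x}$ for $i\geqslant 1$.
   Context: $B_n(x)$ is the type $B$ Eulerian polynomial: $B_n(x)=\sum_{\pi\in\mathfrak{S}_n^B}x^{{\rm des}_B(\pi)}$, where $\mathfrak{S}_n^B$ is the set of signed permutations $\pi(1)\cdots\pi(n)$ of $[n]$ (bijections of $\{\pm1,\ldots,\pm n\}$ with $\pi(-i)=-\pi(i)$) and, with $\pi(0)=0$, ${\rm des}_B(\pi)=\#\{i\in\{0,\ldots,n-1\}:\pi(i)>\pi(i+1)\}$ (e.g. $B_1(x)=1+x$, $B_2(x)=1+6x+x^2$). $\operatorname{SYT}(n)$ is the set of standard Young tableaux with $n$ boxes (French convention). $\ell(\lambda(T))$ is the number of rows of $T$, $w_i(T)$ the number of rows with exactly $i$ boxes. For $1\leqslant i\leqslant n$, $T_i$ is obtained from $T$ by deleting entries $i+1,\ldots,n$, and $\operatorname{col}_k(T_i)$ is the size of its $k$-th column; $\sigma_i(T)=i-\operatorname{col}_1(T_i)+1$ if $i$ lies in the first column of $T$, and $\sigma_i(T)=\operatorname{col}_k(T_i)-\operatorname{col}_{k+1}(T_i)+1$ if $i$ lies in the $(k+1)$-th column, $k\geqslant1$. *)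

theory Defs
  imports Main "HOL-Combinatorics.Permutations" "HOL-Computational_Algebra.Polynomial"
begin

text \<open>Signed permutations are total functions on \<^typ>\<open>int\<close> that are the identity outside
  \<open>{-n, \<dots>, -1, 1, \<dots>, n}\<close>; in particular \<open>\<pi> 0 = 0\<close>.\<close>

definition signed_perms :: "nat \<Rightarrow> (int \<Rightarrow> int) set" where
  "signed_perms n =
     {\<pi>. \<pi> permutes ({- int n..int n} - {0}) \<and> (\<forall>i. \<pi> (- i) = - \<pi> i)}"

definition des_B :: "nat \<Rightarrow> (int \<Rightarrow> int) \<Rightarrow> nat" where
  "des_B n \<pi> = card {i \<in> {0..<int n}. \<pi> i > \<pi> (i + 1)}"

definition eulerian_B :: "nat \<Rightarrow> 'a::comm_semiring_1 poly" where
  "eulerian_B n = (\<Sum>\<pi>\<in>signed_perms n. monom 1 (des_B n \<pi>))"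

text \<open>A tableau is the list of its rows; in the French convention the head of the list is the
  bottom row, and entries increase from left to right and from bottom to top.\<close>

definition SYT :: "nat \<Rightarrow> nat list list set" where
  "SYT n = {T.
     [] \<notin> set T \<and>
     sorted_wrt (\<ge>) (map length T) \<and>
     distinct (concat T) \<and> set (concat T) = {1..n} \<and>
     (\<forall>r\<in>set T. sorted_wrt (<) r) \<and>
     (\<forall>a j. Suc a < length T \<and> j < length (T ! Suc a) \<longrightarrow> T ! a ! j < T ! Suc a ! j)}"

definition num_rows_of_length :: "nat \<Rightarrow> nat list list \<Rightarrow> nat" where
  "num_rows_of_length i T = length (filter (\<lambda>r. length r = i) T)"

definition restrict_tableau :: "nat list list \<Rightarrow> nat \<Rightarrow> nat list list" where
  "restrict_tableau T i = filter (\<lambda>r. r \<noteq> []) (map (filter (\<lambda>e. e \<le> i)) T)"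

text \<open>Columns are numbered from 1; list positions start at 0.\<close>

definition col_size :: "nat \<Rightarrow> nat list list \<Rightarrow> nat" where
  "col_size k T = length (filter (\<lambda>r. k \<le> length r) T)"

definition in_column :: "nat list list \<Rightarrow> nat \<Rightarrow> nat \<Rightarrow> bool" where
  "in_column T i k \<longleftrightarrow> 1 \<le> k \<and> (\<exists>r\<in>set T. k \<le> length r \<and> r ! (k - 1) = i)"

definition column_of :: "nat list list \<Rightarrow> nat \<Rightarrow> nat" where
  "column_of T i = (THE k. in_column T i k)"

definition sigma :: "nat list list \<Rightarrow> nat \<Rightarrow> int" where
  "sigma T i =
     (if column_of T i = 1
      then int i - int (col_size 1 (restrict_tableau T i)) + 1
      else int (col_size (column_of T i - 1) (restrict_tableau T i))
             - int (col_size (column_of T i) (restrict_tableau T i)) + 1)"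

end

theory Submission
  imports Defs
begin

text \<open>
  Put \<open>a = \<surd>x\<close>, \<open>c\<^sub>0 = a b\<close>, and let \<open>D\<close> be the derivation with \<open>D a = b\<close>, \<open>D b = a\<close>. Then
  \<open>c\<^sub>1 = D c\<^sub>0 = a\<^sup>2 + b\<^sup>2\<close> and \<open>D\<^sup>2 c\<^sub>0 = 4 c\<^sub>0\<close>, so at \<open>b = 1\<close> the coefficients of the theorem are
  \<open>c\<^sub>k = D\<^sup>k c\<^sub>0\<close>. Both sides arise from \<open>1\<close> by iterating \<open>p \<mapsto> D (c\<^sub>0 p)\<close> \<open>n\<close> times. For the tableaux, by
  the Leibniz rule \<open>D\<close> turns one factor \<open>c\<^sub>k\<close> into \<open>c\<^bsub>k+1\<^esub>\<close>, i.e. adds a box to a row of length \<open>k\<close>, and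
  \<open>\<sigma>\<^sub>i\<close> counts the rows among which the corner receiving \<open>i\<close> is chosen. For signed permutations, the
  iteration is the recurrence obtained by inserting \<open>n + 1\<close> or \<open>- (n + 1)\<close> into the word of \<open>\<pi>\<close>.
\<close>

section \<open>Signed permutations as words\<close>

text \<open>The word lists the values at 1, ..., n; oddness determines a signed permutation from
  these.\<close>

definition signed_words :: "nat \<Rightarrow> int list set" where
  "signed_words n = {w. distinct (map abs w) \<and> abs ` set w = {1..int n}}"

fun descents :: "int list \<Rightarrow> nat" where
  "descents (a # b # w) = (if a > b then 1 else 0) + descents (b # w)"
| "descents _ = 0"

lemma length_signed_words:
  assumes "w \<in> signed_words n" shows "length w = n"
proof -
  have "length (map abs w) = card (set (map abs w))"
    using assms by (simp add: signed_words_def distinct_card del: length_map set_map)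
  then show ?thesis using assms by (simp add: signed_words_def)
qed

lemma signed_words_abs_le: "w \<in> signed_words n \<Longrightarrow> a \<in> set w \<Longrightarrow> \<bar>a\<bar> < int (Suc n)"
  unfolding signed_words_def by (auto simp: set_eq_iff image_iff) (metis zle_add1_eq_le add.commute)

lemma descents_eq_sum:
  "descents w = (\<Sum>i<length w - 1. if w ! i > w ! Suc i then 1 else 0)"
proof (induction w rule: descents.induct)
  case (1 a b w)
  then show ?case
    by (simp add: sum.lessThan_Suc_shift del: sum.lessThan_Suc)
qed auto

lemma des_B_eq_descents: "des_B n \<pi> = descents (map \<pi> [0..int n])"
proof -
  have "bij_betw int {i. i < n \<and> \<pi> (int i) > \<pi> (int i + 1)} {i \<in> {0..<int n}. \<pi> i > \<pi> (i + 1)}"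
    by (rule bij_betw_byWitness[where f' = nat]) auto
  then have "des_B n \<pi> = card {i. i < n \<and> \<pi> (int i) > \<pi> (int i + 1)}"
    unfolding des_B_def by (rule bij_betw_same_card[symmetric])
  also have "\<dots> = (\<Sum>i<n. if \<pi> (int i) > \<pi> (int i + 1) then 1 else 0)"
    by (simp add: sum.If_cases lessThan_def Collect_conj_eq)
  also have "\<dots> = descents (map \<pi> [0..int n])"
    unfolding descents_eq_sum by (intro sum.cong) (auto simp: add.commute)
  finally show ?thesis .
qed

lemma signed_perms_zero: "\<pi> \<in> signed_perms n \<Longrightarrow> \<pi> 0 = 0"
  by (auto simp: signed_perms_def permutes_def)

lemma bij_betw_signed_perms_words:
  "bij_betw (\<lambda>\<pi>. map \<pi> [1..int n]) (signed_perms n) (signed_words n)"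
  unfolding bij_betw_def
proof
  let ?S = "{- int n..int n} - {0::int}"
  show "inj_on (\<lambda>\<pi>. map \<pi> [1..int n]) (signed_perms n)"
  proof (rule inj_onI, rule ext)
    fix \<pi> \<rho> i
    assume p: "\<pi> \<in> signed_perms n" and r: "\<rho> \<in> signed_perms n"
      and eq: "map \<pi> [1..int n] = map \<rho> [1..int n]"
    have pos: "\<pi> j = \<rho> j" if "1 \<le> j" "j \<le> int n" for j
      using eq that by auto
    consider "1 \<le> i" "i \<le> int n" | "1 \<le> -i" "-i \<le> int n" | "i \<notin> ?S" by force
    then show "\<pi> i = \<rho> i"
    proof cases
      case 2
      then have "- \<pi> i = - \<rho> i" using pos[of "-i"] p r by (simp add: signed_perms_def)
      then show ?thesis by simp
    qed (use pos p r in \<open>auto simp: signed_perms_def permutes_def\<close>)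
  qed
  show "(\<lambda>\<pi>. map \<pi> [1..int n]) ` signed_perms n = signed_words n"
  proof (intro equalityI subsetI)
    fix w assume "w \<in> (\<lambda>\<pi>. map \<pi> [1..int n]) ` signed_perms n"
    then obtain \<pi> where p: "\<pi> permutes ?S" "\<And>i. \<pi> (- i) = - \<pi> i" and w: "w = map \<pi> [1..int n]"
      by (auto simp: signed_perms_def)
    have inj: "inj_on (\<lambda>i. \<bar>\<pi> i\<bar>) {1..int n}"
    proof (rule inj_onI)
      fix i j assume ij: "i \<in> {1..int n}" "j \<in> {1..int n}" "\<bar>\<pi> i\<bar> = \<bar>\<pi> j\<bar>"
      \<comment> \<open>Equal absolute values mean equality up to sign, and oddness moves the sign
        into the argument.\<close>
      then have "\<pi> i = \<pi> j \<or> \<pi> i = \<pi> (- j)" using p(2)[of j] by linarith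
      then have "i = j \<or> i = - j" using permutes_inj[OF p(1)] by (auto simp: inj_def)
      then show "i = j" using ij by auto
    qed
    have sub: "(\<lambda>i. \<bar>\<pi> i\<bar>) ` {1..int n} \<subseteq> {1..int n}"
    proof (rule image_subsetI)
      fix i assume "i \<in> {1..int n}"
      then have "\<pi> i \<in> ?S" using permutes_in_image[OF p(1), of i] by auto
      then show "\<bar>\<pi> i\<bar> \<in> {1..int n}" by auto
    qed
    have "(\<lambda>i. \<bar>\<pi> i\<bar>) ` {1..int n} = {1..int n}"
      using endo_inj_surj[OF _ sub inj] by simp
    moreover have "distinct (map (abs \<circ> \<pi>) [1..int n])"
      using inj by (simp add: distinct_map comp_def)
    ultimately show "w \<in> signed_words n"
      by (simp add: signed_words_def w image_image)
  next
    fix w assume w: "w \<in> signed_words n"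
    have len: "length w = n" using w by (rule length_signed_words)
    \<comment> \<open>The odd extension of the word, fixing 0 and everything outside the range; list
      positions start at 0, hence the \<open>- 1\<close>.\<close>
    define \<pi> where "\<pi> i = (if 1 \<le> i \<and> i \<le> int n then w ! (nat i - 1)
      else if 1 \<le> - i \<and> - i \<le> int n then - w ! (nat (- i) - 1) else i)" for i
    have odd: "\<pi> (- i) = - \<pi> i" for i by (auto simp: \<pi>_def)
    have range: "\<bar>w ! k\<bar> \<in> {1..int n}" if "k < n" for k
      using w that len by (auto simp: signed_words_def)
    have abs_inj: "i = j" if "i < n" "j < n" "\<bar>w ! i\<bar> = \<bar>w ! j\<bar>" for i j
      using w that len by (auto simp: signed_words_def distinct_conv_nth)
    have index: "nat \<bar>i\<bar> - 1 < n" if "i \<in> ?S" for i using that by auto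
    have abs_pi: "\<bar>\<pi> i\<bar> = \<bar>w ! (nat \<bar>i\<bar> - 1)\<bar>" if "i \<in> ?S" for i
      using that by (auto simp: \<pi>_def)
    have "inj_on \<pi> ?S"
    proof (rule inj_onI)
      fix i j assume ij: "i \<in> ?S" "j \<in> ?S" "\<pi> i = \<pi> j"
      then have "\<bar>w ! (nat \<bar>i\<bar> - 1)\<bar> = \<bar>w ! (nat \<bar>j\<bar> - 1)\<bar>"
        using abs_pi by metis
      then have "nat \<bar>i\<bar> - 1 = nat \<bar>j\<bar> - 1" using ij index abs_inj by blast
      then have "\<bar>i\<bar> = \<bar>j\<bar>" using ij by auto
      then have "i = j \<or> i = - j" by linarith
      \<comment> \<open>Letters are nonzero, which rules out \<open>i = - j\<close>.\<close>
      moreover have "\<pi> j \<noteq> - \<pi> j"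
        using abs_pi[OF ij(2)] range[OF index[OF ij(2)]] by auto
      ultimately show "i = j" using ij(3) odd by metis
    qed
    moreover have "\<pi> ` ?S \<subseteq> ?S"
    proof (rule image_subsetI)
      fix i assume i: "i \<in> ?S"
      have "\<bar>\<pi> i\<bar> \<in> {1..int n}" unfolding abs_pi[OF i] using i by (intro range) auto
      then show "\<pi> i \<in> ?S" by auto
    qed
    ultimately have "bij_betw \<pi> ?S ?S"
      by (simp add: bij_betw_def endo_inj_surj)
    then have "\<pi> permutes ?S" by (rule bij_imp_permutes) (auto simp: \<pi>_def)
    then have "\<pi> \<in> signed_perms n" using odd by (simp add: signed_perms_def)
    moreover have "w = map \<pi> [1..int n]"
      by (rule nth_equalityI) (auto simp: len \<pi>_def nat_add_distrib)
    ultimately show "w \<in> (\<lambda>\<pi>. map \<pi> [1..int n]) ` signed_perms n" by blast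
  qed
qed

lemma sum_signed_perms_descents:
  "(\<Sum>\<pi>\<in>signed_perms n. f (des_B n \<pi>)) = (\<Sum>w\<in>signed_words n. f (descents (0 # w)))"
proof -
  have "[0..int n] = 0 # [1..int n]" by (simp add: upto_rec1)
  then have "(\<Sum>\<pi>\<in>signed_perms n. f (des_B n \<pi>)) =
      (\<Sum>\<pi>\<in>signed_perms n. f (descents (0 # map \<pi> [1..int n])))"
    by (intro sum.cong) (simp_all add: des_B_eq_descents signed_perms_zero)
  then show ?thesis
    using sum.reindex_bij_betw[OF bij_betw_signed_perms_words, of "\<lambda>w. f (descents (0 # w))" n] by simp
qed

section \<open>Inserting the letter of largest absolute value\<close>

definition insert_at :: "nat \<Rightarrow> 'a \<Rightarrow> 'a list \<Rightarrow> 'a list" where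
  "insert_at j m w = take j w @ m # drop j w"

lemma set_insert_at [simp]: "set (insert_at j m w) = insert m (set w)"
  by (simp add: insert_at_def) (metis append_take_drop_id set_append)

text \<open>Deleting the unique letter of absolute value n + 1 is the inverse; its position and sign
  give back \<open>j\<close> and \<open>m\<close>. There are n + 1 gaps, \<open>j = n\<close> being
  the end of the word.\<close>

lemma bij_betw_insert_at:
  "bij_betw (\<lambda>(w, j, m). insert_at j m w)
     (signed_words n \<times> {..n} \<times> {int (Suc n), - int (Suc n)}) (signed_words (Suc n))"
  unfolding bij_betw_def
proof
  let ?N = "int (Suc n)"
  have notin: "?N \<notin> set (map abs w)" if "w \<in> signed_words n" for w
    using that by (auto simp: signed_words_def)
  show "inj_on (\<lambda>(w, j, m). insert_at j m w) (signed_words n \<times> {..n} \<times> {?N, - ?N})"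
  proof (rule inj_onI)
    fix s s'
    assume s: "s \<in> signed_words n \<times> {..n} \<times> {?N, - ?N}" "s' \<in> signed_words n \<times> {..n} \<times> {?N, - ?N}"
      and ss: "(\<lambda>(w, j, m). insert_at j m w) s = (\<lambda>(w, j, m). insert_at j m w) s'"
    obtain w j m w' j' m' where tup: "s = (w, j, m)" "s' = (w', j', m')" by (metis prod_cases3)
    have w: "w \<in> signed_words n" "j \<le> n" "m \<in> {?N, - ?N}"
      and w': "w' \<in> signed_words n" "j' \<le> n" "m' \<in> {?N, - ?N}"
      and eq: "insert_at j m w = insert_at j' m' w'"
      using s ss tup by auto
    have abs: "\<bar>m\<bar> = ?N" "\<bar>m'\<bar> = ?N" using w w' by auto
    \<comment> \<open>After taking absolute values the inserted letter is the same on both sides and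
      occurs nowhere else, so the two splittings agree.\<close>
    have "map abs (insert_at j m w) = map abs (insert_at j' m' w')" using eq by simp
    then have "take j (map abs w) @ ?N # drop j (map abs w) =
        take j' (map abs w') @ ?N # drop j' (map abs w')"
      by (simp only: insert_at_def map_append list.map take_map drop_map abs)
    moreover have "?N \<notin> set (take j (map abs w))" "?N \<notin> set (drop j (map abs w))"
      using notin[OF w(1)] by (meson in_set_takeD in_set_dropD)+
    ultimately have "take j (map abs w) = take j' (map abs w')"
      by (metis append_Cons_eq_iff)
    then have "length (take j (map abs w)) = length (take j' (map abs w'))" by simp
    then have jj: "j = j'" using w w' length_signed_words by force
    then have "take j w = take j w' \<and> m = m' \<and> drop j w = drop j w'"
      using eq w w' length_signed_words by (auto simp: insert_at_def)
    then show "s = s'"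
      using jj tup by (metis append_take_drop_id)
  qed
  show "(\<lambda>(w, j, m). insert_at j m w) ` (signed_words n \<times> {..n} \<times> {?N, - ?N}) =
      signed_words (Suc n)"
  proof (intro equalityI image_subsetI subsetI)
    fix s assume "s \<in> signed_words n \<times> {..n} \<times> {?N, - ?N}"
    then obtain w j m where s: "s = (w, j, m)"
      and w: "w \<in> signed_words n" "j \<le> n" "m \<in> {?N, - ?N}" by (cases s) blast
    have "distinct (map abs (take j w @ drop j w))" using w by (simp add: signed_words_def)
    moreover have "\<bar>m\<bar> \<notin> abs ` set (take j w @ drop j w)" using w by (auto simp: signed_words_def)
    ultimately have "distinct (map abs (insert_at j m w))"
      unfolding insert_at_def by (auto simp del: append_take_drop_id)
    moreover have "abs ` set (insert_at j m w) = {1..int (Suc n)}"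
      using w by (auto simp: signed_words_def)
    ultimately show "(\<lambda>(w, j, m). insert_at j m w) s \<in> signed_words (Suc n)"
      by (simp add: s signed_words_def)
  next
    fix w assume w: "w \<in> signed_words (Suc n)"
    then have "?N \<in> abs ` set w" by (simp add: signed_words_def)
    then obtain u m v where uv: "w = u @ m # v" and m: "\<bar>m\<bar> = ?N" by (metis imageE in_set_conv_decomp)
    have d: "distinct (map abs (u @ v))" and nn: "?N \<notin> abs ` set (u @ v)"
      using w uv m by (auto simp: signed_words_def)
    have "insert ?N (abs ` set (u @ v)) = {1..?N}"
      using w uv m by (auto simp: signed_words_def)
    then have "abs ` set (u @ v) = {1..?N} - {?N}" using nn by blast
    then have "u @ v \<in> signed_words n" using d by (auto simp: signed_words_def)
    moreover from this have "length u \<le> n" using length_signed_words[of "u @ v" n] by simp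
    moreover have "m \<in> {?N, - ?N}" using m by auto
    moreover have "w = insert_at (length u) m (u @ v)" using uv by (simp add: insert_at_def)
    ultimately show "w \<in> (\<lambda>(w, j, m). insert_at j m w) `
        (signed_words n \<times> {..n} \<times> {?N, - ?N})"
      by (intro image_eqI[of _ _ "(u @ v, length u, m)"]) auto
  qed
qed

text \<open>Inside a descent, inserting either \<open>m\<close> or \<open>- m\<close> preserves the
  number of descents; between any other neighbours either one raises it by 1. At the end of the word
  \<open>m\<close> preserves it and \<open>- m\<close> raises it. With d descents in
  \<open>a # w\<close>, this makes 2 d + 1 insertions of the first kind and 2 (length w - d) + 1 of
  the second.\<close>

lemma sum_insert_at_descents:
  fixes y :: "'a::comm_ring_1" and m :: int
  assumes "\<forall>b\<in>set (a # w). \<bar>b\<bar> < m"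
  shows "(\<Sum>j\<le>length w. y ^ descents (a # insert_at j m w) + y ^ descents (a # insert_at j (- m) w)) =
    of_int (2 * int (descents (a # w)) + 1) * y ^ descents (a # w) +
    of_int (2 * int (length w) - 2 * int (descents (a # w)) + 1) * y ^ Suc (descents (a # w))"
  using assms
proof (induction w arbitrary: a)
  case Nil
  then show ?case by (auto simp: insert_at_def abs_less_iff)
next
  case (Cons b w)
  have less: "a < m" "- m < a" "b < m" "- m < b"
    using Cons.prems by (simp_all add: abs_less_iff)
  have IH: "(\<Sum>j\<le>length w. y ^ descents (b # insert_at j m w) + y ^ descents (b # insert_at j (- m) w)) =
    of_int (2 * int (descents (b # w)) + 1) * y ^ descents (b # w) +
    of_int (2 * int (length w) - 2 * int (descents (b # w)) + 1) * y ^ Suc (descents (b # w))"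
    using Cons.prems by (intro Cons.IH) auto
  have step: "(\<Sum>j\<le>length (b # w). y ^ descents (a # insert_at j m (b # w))
        + y ^ descents (a # insert_at j (- m) (b # w))) =
      2 * y ^ Suc (descents (b # w)) + (if a > b then y else 1) *
      (\<Sum>j\<le>length w. y ^ descents (b # insert_at j m w) + y ^ descents (b # insert_at j (- m) w))"
    using less by (simp add: sum.atMost_Suc_shift insert_at_def sum_distrib_left distrib_left
        del: sum.atMost_Suc)
  show ?case unfolding step IH by (cases "a > b") (simp_all add: algebra_simps)
qed

section \<open>A graded derivation\<close>

text \<open>\<open>X\<close> stands for \<surd>x, so half-integral powers of x become powers of
  \<open>X\<close>.\<close>

definition X :: "int poly" where "X = [:0, 1:]"

text \<open>On homogeneous polynomials of degree \<open>2 * n\<close> in \<open>a, b\<close>, dehomogenised at \<open>b = 1\<close>, this is the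
  derivation \<open>a \<mapsto> b\<close>, \<open>b \<mapsto> a\<close>; by Euler's identity \<open>b * \<partial>\<^sub>b\<close> acts as \<open>2 * n - a * \<partial>\<^sub>a\<close>.\<close>

definition D :: "nat \<Rightarrow> int poly \<Rightarrow> int poly" where
  "D n p = (1 - X ^ 2) * pderiv p + of_nat (2 * n) * X * p"

text \<open>Starting at index 0 gives an empty row the weight \<open>X\<close>, so that opening a
  new row is a case of lengthening a row.\<close>

fun C :: "nat \<Rightarrow> int poly" where
  "C 0 = X"
| "C (Suc 0) = 1 + X ^ 2"
| "C (Suc (Suc k)) = 4 * C k"

lemma pderiv_X [simp]: "pderiv X = 1"
  by (simp add: X_def pderiv_pCons one_pCons)

text \<open>The term \<open>of_nat (2 * n) * X * p\<close> is linear in the grade, so it splits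
  between the two factors.\<close>

lemma D_mult: "D (m + n) (p * q) = D m p * q + p * D n q"
  by (simp add: D_def pderiv_mult algebra_simps)

lemma D_sum: "D n (\<Sum>i\<in>A. f i) = (\<Sum>i\<in>A. D n (f i))"
proof -
  have "pderiv (\<Sum>i\<in>A. f i) = (\<Sum>i\<in>A. pderiv (f i))"
    by (induction A rule: infinite_finite_induct) (simp_all add: pderiv_add)
  then show ?thesis by (simp add: D_def sum.distrib sum_distrib_left)
qed

lemma of_int_mult_eq_smult: "of_int k * p = smult k (p :: int poly)"
  by (simp add: of_int_poly)

lemma D_of_int_mult: "D n (of_int k * p) = of_int k * D n p"
  unfolding of_int_mult_eq_smult D_def pderiv_smult by (simp add: algebra_simps smult_add_right smult_diff_right)

text \<open>Since \<open>D 1 X = 1 + X ^ 2\<close> and \<open>D 1 (1 + X ^ 2) = 4 * X\<close>,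
  iterating \<open>D 1\<close> has period two up to the factor 4.\<close>

lemma D_C: "D 1 (C k) = C (Suc k)"
proof (induction k rule: C.induct)
  case (3 k)
  have "D 1 (C (Suc (Suc k))) = D 1 (of_int 4 * C k)" by simp
  then show ?case unfolding D_of_int_mult 3 by simp
qed (simp_all add: D_def pderiv_add pderiv_mult algebra_simps power2_eq_square)

text \<open>The coefficients are those of \<open>sum_insert_at_descents\<close> for a word of length
  \<open>n\<close> with \<open>d\<close> descents and \<open>y = X ^ 2\<close>.\<close>

lemma D_X_power:
  "D (Suc n) (X * (X ^ 2) ^ d) =
    of_int (2 * int d + 1) * (X ^ 2) ^ d + of_int (2 * int n - 2 * int d + 1) * (X ^ 2) ^ Suc d"
proof -
  have "pderiv (X ^ Suc (2 * d)) = of_int (2 * int d + 1) * X ^ (2 * d)"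
    by (simp only: pderiv_power_Suc pderiv_X of_int_mult_eq_smult) (simp add: add.commute)
  then have "D (Suc n) (X ^ Suc (2 * d)) =
     (1 - X ^ 2) * (of_int (2 * int d + 1) * X ^ (2 * d)) + of_nat (2 * Suc n) * X * X ^ Suc (2 * d)"
    by (simp only: D_def)
  also have "\<dots> = of_int (2 * int d + 1) * X ^ (2 * d)
      + of_int (2 * int n - 2 * int d + 1) * X ^ (2 * Suc d)"
    by (simp add: algebra_simps power2_eq_square)
  finally show ?thesis by (simp only: power_mult power_Suc)
qed

text \<open>Every \<open>C k\<close> has grade 1, so the grade of the product is its number of
  factors, and the Leibniz rule raises one index at a time.\<close>

lemma D_prod_list_C:
  "D (length ks) (prod_list (map C ks)) =
    (\<Sum>p<length ks. prod_list (map C (ks[p := Suc (ks ! p)])))"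
proof (induction ks)
  case Nil
  show ?case by (simp add: D_def)
next
  case (Cons k ks)
  have "D (length (k # ks)) (prod_list (map C (k # ks))) =
     D 1 (C k) * prod_list (map C ks) + C k * D (length ks) (prod_list (map C ks))"
    using D_mult[of 1 "length ks"] by simp
  also have "\<dots> = (\<Sum>p<length (k # ks). prod_list (map C ((k # ks)[p := Suc ((k # ks) ! p)])))"
    unfolding Cons D_C
    by (simp add: sum.lessThan_Suc_shift sum_distrib_left del: sum.lessThan_Suc)
  finally show ?case .
qed

section \<open>Recurrence for the type B Eulerian polynomials at \<open>X ^ 2\<close>\<close>

definition eulerian_sq :: "nat \<Rightarrow> int poly" where
  "eulerian_sq n = (\<Sum>\<pi>\<in>signed_perms n. (X ^ 2) ^ des_B n \<pi>)"

text \<open>The 2 n + 2 insertions into one word together contribute \<open>D (Suc n)\<close> of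
  \<open>X\<close> times the monomial of that word.\<close>

lemma eulerian_sq_Suc: "eulerian_sq (Suc n) = D (Suc n) (X * eulerian_sq n)"
proof -
  let ?N = "int (Suc n)"
  have "eulerian_sq (Suc n) = (\<Sum>w\<in>signed_words (Suc n). (X ^ 2) ^ descents (0 # w))"
    unfolding eulerian_sq_def by (rule sum_signed_perms_descents)
  also have "\<dots> = (\<Sum>(w, j, m)\<in>signed_words n \<times> {..n} \<times> {?N, - ?N}.
      (X ^ 2) ^ descents (0 # insert_at j m w))"
    by (subst sum.reindex_bij_betw[OF bij_betw_insert_at, symmetric])
      (intro sum.cong, auto)
  also have "\<dots> = (\<Sum>w\<in>signed_words n. \<Sum>j\<le>length w.
      (X ^ 2) ^ descents (0 # insert_at j ?N w) + (X ^ 2) ^ descents (0 # insert_at j (- ?N) w))"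
    by (simp add: sum.cartesian_product[symmetric] length_signed_words)
  also have "\<dots> = (\<Sum>w\<in>signed_words n. D (Suc n) (X * (X ^ 2) ^ descents (0 # w)))"
  proof (rule sum.cong)
    fix w assume w: "w \<in> signed_words n"
    then have "\<forall>b\<in>set (0 # w). \<bar>b\<bar> < ?N" using signed_words_abs_le by auto
    then show "(\<Sum>j\<le>length w. (X ^ 2) ^ descents (0 # insert_at j ?N w)
          + (X ^ 2) ^ descents (0 # insert_at j (- ?N) w)) =
        D (Suc n) (X * (X ^ 2) ^ descents (0 # w))"
      using sum_insert_at_descents[of 0 w ?N "X ^ 2"]
      by (simp only: D_X_power length_signed_words[OF w])
  qed simp
  also have "\<dots> = D (Suc n) (X * eulerian_sq n)"
    unfolding eulerian_sq_def sum_signed_perms_descents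
    by (simp add: D_sum sum_distrib_left)
  finally show ?thesis .
qed

section \<open>Adding a box to a standard Young tableau\<close>

text \<open>A transitive form of the row comparison in the definition of \<^const>\<open>SYT\<close>, so that
  \<^const>\<open>sorted_wrt\<close> can be used for both shape and columns.\<close>

definition row_le :: "nat list \<Rightarrow> nat list \<Rightarrow> bool" where
  "row_le r s \<longleftrightarrow> length s \<le> length r \<and> (\<forall>j<length s. r ! j < s ! j)"

lemma transp_row_le: "transp row_le"
  by (rule transpI) (auto simp: row_le_def, metis le_trans less_le_trans less_trans)

text \<open>By transitivity, comparing adjacent rows is the same as comparing all pairs of
  rows.\<close>

lemma SYT_iff:
  "T \<in> SYT n \<longleftrightarrow> [] \<notin> set T \<and> sorted_wrt row_le T \<and> distinct (concat T) \<and>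
    set (concat T) = {1..n} \<and> (\<forall>r\<in>set T. sorted_wrt (<) r)"
proof -
  have "sorted_wrt row_le T \<longleftrightarrow> sorted_wrt (\<ge>) (map length T) \<and>
     (\<forall>a j. Suc a < length T \<and> j < length (T ! Suc a) \<longrightarrow> T ! a ! j < T ! Suc a ! j)"
    unfolding sorted_wrt_map sorted_wrt_iff_nth_Suc_transp[OF transp_row_le]
    by (subst sorted_wrt_iff_nth_Suc_transp) (auto simp: row_le_def transp_def)
  then show ?thesis by (auto simp: SYT_def)
qed

lemma SYT_le: "T \<in> SYT n \<Longrightarrow> r \<in> set T \<Longrightarrow> e \<in> set r \<Longrightarrow> e \<le> n"
  by (auto simp: SYT_iff set_eq_iff)

lemma length_concat_SYT:
  assumes "T \<in> SYT n" shows "length (concat T) = n"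
  using assms distinct_card[of "concat T"] by (simp add: SYT_iff)

lemma length_row_SYT:
  assumes "T \<in> SYT n" "r \<in> set T" shows "1 \<le> length r" "length r \<le> n"
proof -
  show "1 \<le> length r" using assms by (cases r) (auto simp: SYT_iff)
  obtain A B where "T = A @ r # B" using assms(2) by (metis in_set_conv_decomp)
  then have "length r \<le> length (concat T)" by simp
  then show "length r \<le> n" using length_concat_SYT[OF assms(1)] by simp
qed

lemma length_SYT_le:
  assumes "T \<in> SYT n" shows "length T \<le> n"
proof -
  have "length T \<le> length (concat T)" if "\<forall>r\<in>set T. 1 \<le> length r" for T :: "nat list list"
    using that by (induction T) force+
  then show ?thesis using length_concat_SYT[OF assms] length_row_SYT[OF assms] by metis
qed

lemma SYT_0: "SYT 0 = {[]}"
proof -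
  have "T = []" if "T \<in> SYT 0" for T using length_SYT_le[OF that] by simp
  moreover have "[] \<in> SYT 0" by (simp add: SYT_iff)
  ultimately show ?thesis by blast
qed

text \<open>Row lengths weakly decrease, so a row can grow exactly when it is the first of its
  length. Opening a new row is kept apart from these positions.\<close>

definition corners :: "nat list list \<Rightarrow> nat set" where
  "corners T = {p. p < length T \<and> (\<forall>q<p. length (T ! p) < length (T ! q))}"

text \<open>The position \<open>p = length T\<close> encodes opening a new row.\<close>

definition add_box :: "nat \<Rightarrow> nat list list \<Rightarrow> nat \<Rightarrow> nat list list" where
  "add_box m T p = (if p = length T then T @ [[m]] else T[p := T ! p @ [m]])"

lemma finite_corners [simp]: "finite (corners T)"
  by (simp add: corners_def)

lemma add_box_length [simp]: "add_box m T (length T) = T @ [[m]]"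
  by (simp add: add_box_def)

lemma add_box_append [simp]: "add_box m (A @ r # B) (length A) = A @ (r @ [m]) # B"
  by (simp add: add_box_def)

lemma corners_append:
  "length A \<in> corners (A @ r # B) \<longleftrightarrow> (\<forall>a\<in>set A. length r < length a)"
  by (auto simp: corners_def nth_append all_set_conv_all_nth)

lemma add_box_cases:
  assumes "p \<in> insert (length T) (corners T)"
  obtains (new) "p = length T" "add_box m T p = T @ [[m]]"
  | (extend) A r B where "T = A @ r # B" "p = length A" "\<forall>a\<in>set A. length r < length a"
      "add_box m T p = A @ (r @ [m]) # B"
proof (cases "p = length T")
  case False
  then have p: "p < length T" "p \<in> corners T" using assms by (auto simp: corners_def)
  define A r B where "A = take p T" and "r = T ! p" and "B = drop (Suc p) T"
  have "T = A @ r # B" "p = length A"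
    using p by (simp_all add: A_def r_def B_def id_take_nth_drop)
  then show ?thesis using extend p(2) corners_append add_box_append by metis
qed (use new in simp)

text \<open>The new entry exceeds all others, so it only needs a box below it in every earlier row;
  at a corner those rows are strictly longer.\<close>

lemma add_box_SYT:
  assumes T: "T \<in> SYT n" and p: "p \<in> insert (length T) (corners T)"
  shows "add_box (Suc n) T p \<in> SYT (Suc n)"
  using p
proof (cases rule: add_box_cases[where m = "Suc n"])
  case new
  have "row_le r [Suc n]" if r: "r \<in> set T" for r
  proof -
    have "r \<noteq> []" using T r by (auto simp: SYT_iff)
    then show ?thesis using SYT_le[OF T r, of "r ! 0"] by (simp add: row_le_def Suc_le_eq)
  qed
  moreover have "Suc n \<notin> set (concat T)" using T by (simp add: SYT_iff)
  ultimately show ?thesis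
    using T unfolding new SYT_iff by (auto simp: sorted_wrt_append atLeastAtMostSuc_conv)
next
  case (extend A r B)
  have "row_le a (r @ [Suc n])" if a: "a \<in> set A" for a
  proof -
    have *: "row_le a r" "length r < length a"
      using a T extend by (auto simp: SYT_iff sorted_wrt_append)
    then have "a ! length r \<le> n" using SYT_le[OF T, of a] a extend by simp
    then show ?thesis using * by (auto simp: row_le_def nth_append less_Suc_eq)
  qed
  moreover have "row_le (r @ [Suc n]) b" if "b \<in> set B" for b
    using T that extend by (auto simp: SYT_iff sorted_wrt_append row_le_def nth_append)
  moreover have "Suc n \<notin> set (concat T)" using T by (simp add: SYT_iff)
  moreover have "\<forall>e\<in>set r. e < Suc n" using SYT_le[OF T, of r] extend by (simp add: le_imp_less_Suc)
  moreover have "set (concat (A @ (r @ [Suc n]) # B)) = insert (Suc n) (set (concat T))"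
    using extend by auto
  ultimately show ?thesis
    using T extend(1) unfolding extend(4) SYT_iff
    by (auto simp: sorted_wrt_append atLeastAtMostSuc_conv)
qed

text \<open>The largest entry ends its row and no later row reaches its column, so deleting it
  leaves a tableau.\<close>

lemma SYT_Suc_obtain:
  assumes U: "U \<in> SYT (Suc n)"
  obtains T p where "T \<in> SYT n" "p \<in> insert (length T) (corners T)" "U = add_box (Suc n) T p"
proof -
  have "Suc n \<in> set (concat U)" using U by (simp add: SYT_iff)
  then obtain s where s: "s \<in> set U" "Suc n \<in> set s" by auto
  then obtain A B where AB: "U = A @ s # B" by (metis in_set_conv_decomp)
  obtain r r' where rr: "s = r @ Suc n # r'" using s(2) by (metis in_set_conv_decomp)
  have "r' = []"
  proof (cases r')
    case (Cons e es)
    then have "Suc n < e" using U s(1) rr by (auto simp: SYT_iff sorted_wrt_append)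
    then show ?thesis using SYT_le[OF U s(1), of e] rr Cons by simp
  qed simp
  then have sr: "s = r @ [Suc n]" using rr by simp
  have conc: "insert (Suc n) (set (concat (A @ r # B))) = {1..Suc n}"
    and notin: "Suc n \<notin> set (concat (A @ r # B))"
    using U AB sr by (auto simp: SYT_iff)
  have conc': "set (concat (A @ r # B)) = {1..n}"
  proof -
    have "set (concat (A @ r # B)) = {1..Suc n} - {Suc n}"
      unfolding conc[symmetric] using notin by (rule Diff_insert_absorb[symmetric])
    then show ?thesis by (simp only:) auto
  qed
  \<comment> \<open>A longer row would have an entry above \<open>Suc n\<close> in the same column,
    which would have to exceed it.\<close>
  have shorter: "length b \<le> length r" if b: "b \<in> set B" for b
  proof (rule ccontr)
    assume "\<not> length b \<le> length r"
    moreover have "row_le s b" using U AB b by (auto simp: SYT_iff sorted_wrt_append)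
    ultimately have "length r < length b" "s ! length r < b ! length r"
      by (auto simp: row_le_def)
    then show False using SYT_le[OF U, of b "b ! length r"] AB b sr by simp
  qed
  show ?thesis
  proof (cases "r = []")
    case True
    \<comment> \<open>If \<open>Suc n\<close> is alone in its row, any later row would be
      empty.\<close>
    have "B = []"
    proof (cases B)
      case (Cons b B')
      then have "length b = 0" using shorter[of b] True by simp
      then show ?thesis using U AB Cons by (simp add: SYT_iff)
    qed simp
    then have UA: "U = A @ [[Suc n]]" using AB sr True by simp
    moreover have "A \<in> SYT n" using U conc' True \<open>B = []\<close>
      unfolding SYT_iff UA by (auto simp: sorted_wrt_append)
    ultimately show ?thesis using that[of A "length A"] by simp
  next
    case False
    have "row_le a r" "length r < length a" if "a \<in> set A" for a
    proof -
      have "row_le a (r @ [Suc n])" using U that unfolding AB sr by (auto simp: SYT_iff sorted_wrt_append)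
      then show "row_le a r" "length r < length a"
        by (auto simp: row_le_def nth_append) (metis less_Suc_eq)
    qed
    moreover have "row_le r b" if b: "b \<in> set B" for b
    proof -
      have "row_le (r @ [Suc n]) b" using U b unfolding AB sr by (auto simp: SYT_iff sorted_wrt_append)
      then show ?thesis using shorter[OF b] by (auto simp: row_le_def nth_append)
    qed
    ultimately have "A @ r # B \<in> SYT n" "length A \<in> corners (A @ r # B)"
      using U False conc' unfolding AB sr
      by (auto simp: SYT_iff sorted_wrt_append corners_append)
    then show ?thesis using that[of "A @ r # B" "length A"] AB sr by simp
  qed
qed

lemma restrict_add_box:
  assumes "i < m" "p \<le> length T"
  shows "restrict_tableau (add_box m T p) i = restrict_tableau T i"
proof (cases "p = length T")
  case False
  have "map (filter (\<lambda>e. e \<le> i)) (T[p := T ! p @ [m]]) = map (filter (\<lambda>e. e \<le> i)) T"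
    using assms False by (simp add: map_update list_update_same_conv)
  then show ?thesis using False by (simp add: restrict_tableau_def add_box_def)
qed (use assms in \<open>simp add: restrict_tableau_def\<close>)

lemma restrict_SYT:
  assumes "T \<in> SYT n" shows "restrict_tableau T n = T"
proof -
  have "map (filter (\<lambda>e. e \<le> n)) T = T"
    using SYT_le[OF assms] by (simp add: map_idI)
  moreover have "filter (\<lambda>r. r \<noteq> []) T = T"
    using assms by (auto simp: SYT_iff intro!: filter_True)
  ultimately show ?thesis by (simp add: restrict_tableau_def)
qed

text \<open>Restricting to the entries at most n recovers \<open>T\<close>, and the row containing n
  + 1 recovers \<open>p\<close>.\<close>

lemma bij_betw_add_box:
  "bij_betw (\<lambda>(T, p). add_box (Suc n) T p) (SIGMA T:SYT n. insert (length T) (corners T)) (SYT (Suc n))"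
  unfolding bij_betw_def
proof
  show "inj_on (\<lambda>(T, p). add_box (Suc n) T p) (SIGMA T:SYT n. insert (length T) (corners T))"
  proof (rule inj_onI, clarify)
    fix T p T' p'
    assume T: "T \<in> SYT n" "p \<in> insert (length T) (corners T)"
      and T': "T' \<in> SYT n" "p' \<in> insert (length T') (corners T')"
      and eq: "add_box (Suc n) T p = add_box (Suc n) T' p'"
    have le: "p \<le> length T" "p' \<le> length T'" using T T' by (auto simp: corners_def)
    have "T = restrict_tableau (add_box (Suc n) T p) n"
      using T le by (simp add: restrict_add_box restrict_SYT)
    also have "\<dots> = T'" unfolding eq using T' le by (simp add: restrict_add_box restrict_SYT)
    finally have TT: "T = T'" .
    have pos: "{i. i < length (add_box (Suc n) T q) \<and> Suc n \<in> set (add_box (Suc n) T q ! i)} = {q}"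
      if "q \<le> length T" for q
    proof -
      have "Suc n \<notin> set (T ! i)" if "i < length T" for i
        using SYT_le[OF T(1) nth_mem[OF that], of "Suc n"] by auto
      then show ?thesis using that
        by (auto simp: add_box_def nth_append nth_list_update less_Suc_eq split: if_splits)
    qed
    have le': "p' \<le> length T" and eq': "add_box (Suc n) T p = add_box (Suc n) T p'"
      using le eq TT by simp_all
    have "{p} = {p'}" using pos[OF le(1), unfolded eq'] pos[OF le'] by (rule trans[OF sym])
    then show "T = T' \<and> p = p'" using TT by simp
  qed
  show "(\<lambda>(T, p). add_box (Suc n) T p) ` (SIGMA T:SYT n. insert (length T) (corners T)) = SYT (Suc n)"
    using add_box_SYT by (force elim: SYT_Suc_obtain)
qed

lemma finite_SYT [simp]: "finite (SYT n)"
proof (induction n)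
  case (Suc n)
  then have "finite (SIGMA T:SYT n. insert (length T) (corners T))" by simp
  then show ?case using bij_betw_finite[OF bij_betw_add_box] by blast
qed (simp add: SYT_0)

lemma sum_SYT_Suc:
  "sum f (SYT (Suc n)) = (\<Sum>T\<in>SYT n. f (add_box (Suc n) T (length T))
      + (\<Sum>p\<in>corners T. f (add_box (Suc n) T p)))"
proof -
  have "sum f (SYT (Suc n)) =
      (\<Sum>(T, p)\<in>(SIGMA T:SYT n. insert (length T) (corners T)). f (add_box (Suc n) T p))"
    by (subst sum.reindex_bij_betw[OF bij_betw_add_box, symmetric]) (simp add: case_prod_unfold)
  also have "\<dots> = (\<Sum>T\<in>SYT n. \<Sum>p\<in>insert (length T) (corners T). f (add_box (Suc n) T p))"
    by (subst sum.Sigma) simp_all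
  also have "\<dots> = (\<Sum>T\<in>SYT n. f (add_box (Suc n) T (length T))
      + (\<Sum>p\<in>corners T. f (add_box (Suc n) T p)))"
    by (intro sum.cong refl sum.insert) (auto simp: corners_def)
  finally show ?thesis .
qed

section \<open>The factors \<open>\<sigma>\<close> when a box is added\<close>

lemma in_column_add_box:
  assumes "i \<noteq> m" "p \<in> insert (length T) (corners T)"
  shows "in_column (add_box m T p) i k \<longleftrightarrow> in_column T i k"
  using assms(2)
proof (cases rule: add_box_cases[where m = m])
  case new
  then show ?thesis using assms(1) by (cases "k = 1") (auto simp: in_column_def)
next
  case (extend A r B)
  have "(k \<le> length (r @ [m]) \<and> (r @ [m]) ! (k - 1) = i) \<longleftrightarrow> (k \<le> length r \<and> r ! (k - 1) = i)"
    if "1 \<le> k"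
    using that assms(1) by (cases "k = Suc (length r)") (auto simp: nth_append)
  then show ?thesis unfolding extend(4) unfolding extend(1) by (auto simp: in_column_def)
qed

text \<open>For an old entry, \<open>sigma\<close> depends only on its column and on the tableau of
  entries up to it; the larger new entry changes neither.\<close>

lemma sigma_add_box:
  assumes "i < m" "p \<in> insert (length T) (corners T)"
  shows "sigma (add_box m T p) i = sigma T i"
proof -
  have "column_of (add_box m T p) i = column_of T i"
    using assms by (simp add: column_of_def in_column_add_box)
  moreover have "p \<le> length T" using assms by (auto simp: corners_def)
  ultimately show ?thesis using assms(1) by (simp add: sigma_def restrict_add_box)
qed

text \<open>The value is the number of empty rows once the shape is padded to n + 1 rows.\<close>

lemma sigma_new_row:
  assumes T: "T \<in> SYT n"
  shows "sigma (add_box (Suc n) T (length T)) (Suc n) = int (Suc n - length T)"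
proof -
  let ?U = "add_box (Suc n) T (length T)"
  have U: "?U \<in> SYT (Suc n)" using add_box_SYT[OF T] by blast
  have not: "r ! (k - 1) \<noteq> Suc n" if "r \<in> set T" "1 \<le> k" "k \<le> length r" for r k
    using SYT_le[OF T that(1), of "r ! (k - 1)"] that by (auto simp: nth_mem)
  have "in_column ?U (Suc n) k \<longleftrightarrow> k = 1" for k
    using not by (auto simp: in_column_def)
  then have "column_of ?U (Suc n) = 1" by (simp add: column_of_def)
  moreover have "col_size 1 ?U = Suc (length T)"
    using length_row_SYT[OF T] by (simp add: col_size_def)
  ultimately show ?thesis
    unfolding sigma_def restrict_SYT[OF U] using length_SYT_le[OF T] by simp
qed

lemma col_size_diff: "int (col_size k T) - int (col_size (Suc k) T) = int (num_rows_of_length k T)"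
  by (induction T) (auto simp: col_size_def num_rows_of_length_def)

text \<open>With k = \<open>length (T ! p)\<close>, the difference of columns k and k + 1 in the
  enlarged tableau counts the rows of length k after row \<open>p\<close> has left them; the summand
  1 in \<open>sigma\<close> restores that row.\<close>

lemma sigma_corner:
  assumes T: "T \<in> SYT n" and p: "p \<in> corners T"
  shows "sigma (add_box (Suc n) T p) (Suc n) = int (num_rows_of_length (length (T ! p)) T)"
proof -
  let ?U = "add_box (Suc n) T p"
  have U: "?U \<in> SYT (Suc n)" using add_box_SYT[OF T] p by blast
  have "p \<in> insert (length T) (corners T)" using p by simp
  then show ?thesis
  proof (cases rule: add_box_cases[where m = "Suc n"])
    case (extend A r B)
    have r: "T ! p = r" using extend by simp
    have not: "s ! (k - 1) \<noteq> Suc n" if "s \<in> set T" "1 \<le> k" "k \<le> length s" for s k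
      using SYT_le[OF T that(1), of "s ! (k - 1)"] that by (auto simp: nth_mem)
    have "in_column ?U (Suc n) k \<longleftrightarrow> k = Suc (length r)" for k
    proof -
      have "in_column ?U (Suc n) k \<longleftrightarrow> 1 \<le> k \<and> k \<le> Suc (length r) \<and> (r @ [Suc n]) ! (k - 1) = Suc n"
        unfolding extend(4) in_column_def using not extend(1) by auto
      also have "\<dots> \<longleftrightarrow> k = Suc (length r)"
        using not[of r k] extend(1) by (cases "k = Suc (length r)") (auto simp: nth_append)
      finally show ?thesis .
    qed
    then have col: "column_of ?U (Suc n) = Suc (length r)" by (simp add: column_of_def)
    \<comment> \<open>A nonempty row puts the new box outside the first column, which selects the
      second branch of \<open>sigma\<close>.\<close>
    have "r \<noteq> []" using T extend(1) by (auto simp: SYT_iff)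
    then have "sigma ?U (Suc n) = int (num_rows_of_length (length r) ?U) + 1"
      unfolding sigma_def restrict_SYT[OF U] col by (simp add: col_size_diff)
    also have "\<dots> = int (num_rows_of_length (length r) T)"
      unfolding extend(4) unfolding extend(1) by (simp add: num_rows_of_length_def)
    finally show ?thesis unfolding r .
  qed (use p in \<open>simp add: corners_def\<close>)
qed

section \<open>The tableau sum\<close>

text \<open>The shape of \<open>T\<close> is padded with \<open>n - length T\<close> empty rows, which carry the powers of \<open>\<surd>x\<close>.\<close>

definition tableau_weight :: "nat \<Rightarrow> nat list list \<Rightarrow> int poly" where
  "tableau_weight n T = prod_list (map (C \<circ> length) T) * X ^ (n - length T)"

definition tableau_sum :: "nat \<Rightarrow> int poly" where
  "tableau_sum n = (\<Sum>T\<in>SYT n. (\<Prod>i=1..n. of_int (sigma T i)) * tableau_weight n T)"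

text \<open>Each length that occurs has exactly one corner, its first row. Since \<open>F\<close>
  depends only on the row length, the sum is grouped along the map \<open>g\<close> sending a row to
  the corner of its length.\<close>

lemma sum_rows_eq_sum_corners:
  fixes F :: "nat \<Rightarrow> 'a::comm_ring_1"
  assumes sorted: "sorted_wrt (\<ge>) (map length T)"
    and F: "\<And>p q. p < length T \<Longrightarrow> q < length T \<Longrightarrow> length (T ! p) = length (T ! q) \<Longrightarrow> F p = F q"
  shows "(\<Sum>q<length T. F q) =
    (\<Sum>p\<in>corners T. of_nat (num_rows_of_length (length (T ! p)) T) * F p)"
proof -
  define g where "g q = (LEAST p. p < length T \<and> length (T ! p) = length (T ! q))" for q
  have g: "g q < length T" "length (T ! g q) = length (T ! q)" if "q < length T" for q
    using LeastI[of "\<lambda>p. p < length T \<and> length (T ! p) = length (T ! q)" q] that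
    by (auto simp: g_def)
  have mono: "length (T ! q) \<le> length (T ! p)" if "p \<le> q" "q < length T" for p q
    using sorted that by (cases "p = q") (auto simp: sorted_wrt_iff_nth_less)
  have g_le: "g q \<le> p" if "p < length T" "length (T ! p) = length (T ! q)" for p q
    using that by (auto simp: g_def intro: Least_le)
  have g_corner: "g q \<in> corners T" if q: "q < length T" for q
  proof -
    have "length (T ! g q) < length (T ! p)" if p: "p < g q" for p
    proof -
      have "length (T ! p) \<noteq> length (T ! q)" using g_le[of p q] p g[OF q] by auto
      then show ?thesis using mono[of p "g q"] p g[OF q] by auto
    qed
    then show ?thesis using g[OF q] by (simp add: corners_def)
  qed
  have fibre: "{q \<in> {..<length T}. g q = p} = {q. q < length T \<and> length (T ! q) = length (T ! p)}"
    if p: "p \<in> corners T" for p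
  proof -
    have g_eq: "g q = p" if q: "q < length T" "length (T ! q) = length (T ! p)" for q
    proof (rule antisym)
      show "g q \<le> p" using g_le[of p q] p q by (simp add: corners_def)
      show "p \<le> g q" using p g[OF q(1)] q by (auto simp: corners_def not_le[symmetric])
    qed
    show ?thesis
    proof (intro set_eqI iffI)
      fix q assume "q \<in> {q \<in> {..<length T}. g q = p}"
      then have "q < length T" "g q = p" by simp_all
      then show "q \<in> {q. q < length T \<and> length (T ! q) = length (T ! p)}"
        using g(2)[of q] by simp
    next
      fix q assume "q \<in> {q. q < length T \<and> length (T ! q) = length (T ! p)}"
      then show "q \<in> {q \<in> {..<length T}. g q = p}"
        using g_eq[of q] by simp
    qed
  qed
  have "(\<Sum>q<length T. F q) = (\<Sum>p\<in>corners T. \<Sum>q | q \<in> {..<length T} \<and> g q = p. F q)"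
    using g_corner by (intro sum.group[symmetric]) auto
  also have "\<dots> = (\<Sum>p\<in>corners T. of_nat (num_rows_of_length (length (T ! p)) T) * F p)"
  proof (rule sum.cong)
    fix p assume p: "p \<in> corners T"
    have "(\<Sum>q | q \<in> {..<length T} \<and> g q = p. F q) =
        (\<Sum>q | q < length T \<and> length (T ! q) = length (T ! p). F p)"
      unfolding fibre[OF p] using p by (intro sum.cong refl F) (auto simp: corners_def)
    then show "(\<Sum>q | q \<in> {..<length T} \<and> g q = p. F q) =
        of_nat (num_rows_of_length (length (T ! p)) T) * F p"
      by (simp add: num_rows_of_length_def length_filter_conv_card)
  qed simp
  finally show ?thesis .
qed

text \<open>Replacing either of two equal entries yields the same multiset.\<close>

lemma prod_list_map_update_cong:
  fixes f :: "nat \<Rightarrow> 'a::comm_monoid_mult"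
  assumes "p < length ks" "q < length ks" "ks ! p = ks ! q"
  shows "prod_list (map f (ks[p := a])) = prod_list (map f (ks[q := a]))"
proof -
  have "mset (ks[p := a]) = mset (ks[q := a])" using assms by (simp add: mset_update)
  then show ?thesis by (metis mset_map prod_mset_prod_list)
qed

text \<open>The extra factor \<open>X\<close> is one more empty row, making n + 1 factors. Raising
  the index of an empty row opens a new row; raising that of a row of \<open>T\<close> is charged to
  the corner of the same length. The multiplicities are the values of \<open>sigma\<close> at the
  new entry.\<close>

lemma D_tableau_weight:
  assumes T: "T \<in> SYT n"
  shows "D (Suc n) (X * tableau_weight n T) =
    of_int (int (Suc n - length T)) * tableau_weight (Suc n) (add_box (Suc n) T (length T)) +
    (\<Sum>p\<in>corners T. of_int (int (num_rows_of_length (length (T ! p)) T)) *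
       tableau_weight (Suc n) (add_box (Suc n) T p))"
proof -
  let ?l = "length T" and ?ks = "map length T @ replicate (Suc n - length T) 0"
  have le: "?l \<le> n" using length_SYT_le[OF T] .
  have len: "length ?ks = Suc n" using le by simp
  have "X * tableau_weight n T = prod_list (map C ?ks)"
    using le by (simp add: tableau_weight_def prod_list_replicate Suc_diff_le comp_def algebra_simps)
  then have "D (Suc n) (X * tableau_weight n T) =
      (\<Sum>p<Suc n. prod_list (map C (?ks[p := Suc (?ks ! p)])))"
    using D_prod_list_C[of ?ks] len by simp
  also have "\<dots> = (\<Sum>p\<in>{..<?l} \<union> {?l..<Suc n}. prod_list (map C (?ks[p := Suc (?ks ! p)])))"
    using le by (intro sum.cong) auto
  also have "\<dots> = (\<Sum>p<?l. prod_list (map C (?ks[p := Suc (?ks ! p)])))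
      + (\<Sum>p=?l..<Suc n. prod_list (map C (?ks[p := Suc (?ks ! p)])))"
    by (intro sum.union_disjoint) auto
  also have "(\<Sum>p=?l..<Suc n. prod_list (map C (?ks[p := Suc (?ks ! p)]))) =
      (\<Sum>p=?l..<Suc n. tableau_weight (Suc n) (add_box (Suc n) T ?l))"
  proof (rule sum.cong)
    fix p assume p: "p \<in> {?l..<Suc n}"
    have "prod_list (map C (?ks[p := Suc (?ks ! p)])) = prod_list (map C (?ks[?l := Suc 0]))"
    proof -
      have 0: "?ks ! p = 0" "?ks ! ?l = 0" using p le by (auto simp: nth_append)
      then have "prod_list (map C (?ks[p := Suc 0])) = prod_list (map C (?ks[?l := Suc 0]))"
        using p le by (intro prod_list_map_update_cong) auto
      then show ?thesis using 0 by simp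
    qed
    also have "\<dots> = tableau_weight (Suc n) (add_box (Suc n) T ?l)"
      using le by (simp add: tableau_weight_def list_update_append Suc_diff_le prod_list_replicate comp_def
          algebra_simps)
    finally show "prod_list (map C (?ks[p := Suc (?ks ! p)])) =
        tableau_weight (Suc n) (add_box (Suc n) T ?l)" .
  qed simp
  also have "\<dots> = of_int (int (Suc n - ?l)) * tableau_weight (Suc n) (add_box (Suc n) T ?l)"
    by simp
  \<comment> \<open>Here \<open>add_box\<close> also acts on rows that are not corners; the result
    need not be a tableau, but the weight only sees row lengths.\<close>
  also have "(\<Sum>p<?l. prod_list (map C (?ks[p := Suc (?ks ! p)]))) =
      (\<Sum>p<?l. tableau_weight (Suc n) (add_box (Suc n) T p))"
  proof (rule sum.cong)
    fix p assume "p \<in> {..<?l}"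
    then have p: "p < ?l" by simp
    then have "map length (add_box (Suc n) T p) = (map length T)[p := Suc (length (T ! p))]"
      by (simp add: add_box_def map_update)
    then have "map (C \<circ> length) (add_box (Suc n) T p) = map C ((map length T)[p := Suc (length (T ! p))])"
      by (metis map_map)
    then show "prod_list (map C (?ks[p := Suc (?ks ! p)])) = tableau_weight (Suc n) (add_box (Suc n) T p)"
      using p by (simp add: tableau_weight_def list_update_append nth_append prod_list_replicate add_box_def)
  qed simp
  also have "\<dots> = (\<Sum>p\<in>corners T. of_nat (num_rows_of_length (length (T ! p)) T) *
       tableau_weight (Suc n) (add_box (Suc n) T p))"
  proof (rule sum_rows_eq_sum_corners)
    show "sorted_wrt (\<ge>) (map length T)" using T by (simp add: SYT_def)
    fix p q assume pq: "p < ?l" "q < ?l" "length (T ! p) = length (T ! q)"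
    have *: "tableau_weight (Suc n) (add_box (Suc n) T i) =
        prod_list (map C ((map length T)[i := Suc (length (T ! i))])) * X ^ (Suc n - ?l)" if "i < ?l" for i
      using that by (simp add: tableau_weight_def add_box_def map_update comp_def)
    show "tableau_weight (Suc n) (add_box (Suc n) T p) = tableau_weight (Suc n) (add_box (Suc n) T q)"
      unfolding *[OF pq(1)] *[OF pq(2)] pq(3)
      using pq by (intro arg_cong2[where f = "(*)"] prod_list_map_update_cong refl) auto
  qed
  finally show ?thesis by (simp add: add.commute)
qed

text \<open>Once n + 1 is split off, the old factors \<open>sigma\<close> are unchanged and the last
  one is the matching coefficient of \<open>D_tableau_weight\<close>.\<close>

lemma tableau_sum_Suc: "tableau_sum (Suc n) = D (Suc n) (X * tableau_sum n)"
proof -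
  let ?P = "\<lambda>T. of_int (\<Prod>i=1..n. sigma T i) :: int poly"
  have prod: "(\<Prod>i=1..Suc n. of_int (sigma (add_box (Suc n) T p) i)) =
      ?P T * of_int (sigma (add_box (Suc n) T p) (Suc n))"
    if "p \<in> insert (length T) (corners T)" for T p
  proof -
    have "(\<Prod>i=1..n. of_int (sigma (add_box (Suc n) T p) i)) = ?P T"
      using sigma_add_box[OF _ that] by (simp add: of_int_prod)
    then show ?thesis by (simp add: mult.commute)
  qed
  have "tableau_sum (Suc n) = (\<Sum>T\<in>SYT n. ?P T * D (Suc n) (X * tableau_weight n T))"
    unfolding tableau_sum_def sum_SYT_Suc
  proof (rule sum.cong)
    fix T assume T: "T \<in> SYT n"
    show "(\<Prod>i=1..Suc n. of_int (sigma (add_box (Suc n) T (length T)) i)) *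
          tableau_weight (Suc n) (add_box (Suc n) T (length T)) +
        (\<Sum>p\<in>corners T. (\<Prod>i=1..Suc n. of_int (sigma (add_box (Suc n) T p) i)) *
          tableau_weight (Suc n) (add_box (Suc n) T p)) =
        ?P T * D (Suc n) (X * tableau_weight n T)"
      unfolding D_tableau_weight[OF T] distrib_left sum_distrib_left mult.assoc[symmetric]
      by (intro arg_cong2[where f = "(+)"] sum.cong refl)
        (simp_all only: prod insertI1 insertI2 sigma_new_row[OF T] sigma_corner[OF T])
  qed simp
  \<comment> \<open>The products of \<open>sigma\<close> are integer constants, so they pass through
    \<open>D\<close>.\<close>
  also have "\<dots> = D (Suc n) (\<Sum>T\<in>SYT n. ?P T * (X * tableau_weight n T))"
    by (simp only: D_sum D_of_int_mult)
  also have "(\<Sum>T\<in>SYT n. ?P T * (X * tableau_weight n T)) = X * tableau_sum n"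
    by (simp add: tableau_sum_def sum_distrib_left of_int_prod algebra_simps)
  finally show ?thesis .
qed

text \<open>Both sequences start at 1 and satisfy the same recurrence.\<close>

lemma tableau_sum_eq_eulerian_sq: "tableau_sum n = eulerian_sq n"
proof (induction n)
  case 0
  have "signed_perms 0 = {id}"
    by (auto simp: signed_perms_def permutes_empty)
  then show ?case
    by (simp add: tableau_sum_def eulerian_sq_def SYT_0 tableau_weight_def des_B_def)
next
  case (Suc n)
  then show ?case by (simp add: tableau_sum_Suc eulerian_sq_Suc)
qed

section \<open>Specialisation to a commutative ring\<close>

text \<open>The ring homomorphism from the integer polynomials that sends \<open>X\<close> to
  \<open>s\<close>; it carries the identity to any commutative ring.\<close>

definition eval_poly_at :: "'a::comm_ring_1 \<Rightarrow> int poly \<Rightarrow> 'a" where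
  "eval_poly_at s p = poly (map_poly of_int p) s"

lemma eval_poly_at_0 [simp]: "eval_poly_at s 0 = 0"
  by (simp add: eval_poly_at_def)

lemma eval_poly_at_pCons [simp]: "eval_poly_at s (pCons a p) = of_int a + s * eval_poly_at s p"
  by (simp add: eval_poly_at_def map_poly_pCons)

lemma eval_poly_at_1 [simp]: "eval_poly_at s 1 = 1"
  by (simp add: one_pCons)

lemma eval_poly_at_X [simp]: "eval_poly_at s X = s"
  by (simp add: X_def)

lemma eval_poly_at_add [simp]: "eval_poly_at s (p + q) = eval_poly_at s p + eval_poly_at s q"
  by (induction p q rule: poly_induct2) (simp_all add: algebra_simps)

lemma eval_poly_at_smult [simp]: "eval_poly_at s (smult a p) = of_int a * eval_poly_at s p"
  by (induction p) (simp_all add: algebra_simps)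

lemma eval_poly_at_mult [simp]: "eval_poly_at s (p * q) = eval_poly_at s p * eval_poly_at s q"
  by (induction p) (simp_all add: algebra_simps)

lemma eval_poly_at_power [simp]: "eval_poly_at s (p ^ k) = eval_poly_at s p ^ k"
  by (induction k) simp_all

lemma eval_poly_at_of_int [simp]: "eval_poly_at s (of_int k) = of_int k"
  by (simp add: of_int_poly)

lemma eval_poly_at_numeral [simp]: "eval_poly_at s (numeral k) = numeral k"
  by (metis eval_poly_at_of_int of_int_numeral)

lemma eval_poly_at_sum: "eval_poly_at s (\<Sum>i\<in>A. f i) = (\<Sum>i\<in>A. eval_poly_at s (f i))"
  by (induction A rule: infinite_finite_induct) simp_all

lemma eval_poly_at_prod: "eval_poly_at s (\<Prod>i\<in>A. f i) = (\<Prod>i\<in>A. eval_poly_at s (f i))"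
  by (induction A rule: infinite_finite_induct) simp_all

lemma eval_poly_at_prod_list: "eval_poly_at s (prod_list ps) = prod_list (map (eval_poly_at s) ps)"
  by (induction ps) simp_all

lemma C_closed_form:
  "C (2 * i + 1) = of_int (4 ^ i) * (1 + X ^ 2)" "C (2 * i) = of_int (4 ^ i) * X"
  by (induction i) simp_all

text \<open>Each row contributes one factor, collected at the index equal to its length.\<close>

lemma prod_power_num_rows:
  fixes c :: "nat \<Rightarrow> 'a::comm_monoid_mult"
  assumes "finite I" "\<forall>r\<in>set T. length r \<in> I"
  shows "(\<Prod>i\<in>I. c i ^ num_rows_of_length i T) = prod_list (map (c \<circ> length) T)"
  using assms(2)
proof (induction T)
  case (Cons r T)
  have "(\<Prod>i\<in>I. c i ^ num_rows_of_length i (r # T)) =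
      (\<Prod>i\<in>I. (if i = length r then c i else 1) * c i ^ num_rows_of_length i T)"
    by (intro prod.cong) (auto simp: num_rows_of_length_def)
  then show ?case using Cons assms(1) by (simp add: prod.distrib)
qed (simp add: num_rows_of_length_def)

text \<open>The power of x with exponent (n - \<ell>)/2 is written as a power of a chosen square
  root of \<open>x\<close>; the subtraction never truncates, as a tableau has at most
  \<open>n\<close> rows.\<close>

theorem theorem4p10:
  fixes n :: nat and x sqrt_x :: "'a::comm_ring_1" and c :: "nat \<Rightarrow> 'a"
  assumes "n \<ge> 1"
    and "sqrt_x ^ 2 = x"
    and "\<And>i. i \<ge> 1 \<Longrightarrow> c (2 * i - 1) = 4 ^ (i - 1) * (1 + x)"
    and "\<And>i. i \<ge> 1 \<Longrightarrow> c (2 * i) = 4 ^ i * sqrt_x"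
  shows "poly (eulerian_B n) x =
    (\<Sum>T\<in>SYT n. (\<Prod>i=1..n. of_int (sigma T i) * c i ^ num_rows_of_length i T)
                 * sqrt_x ^ (n - length T))"
proof -
  let ?\<phi> = "eval_poly_at sqrt_x"
  have c: "?\<phi> (C k) = c k" if "k \<ge> 1" for k
  proof (cases "even k")
    case True
    then obtain i where i: "k = 2 * i" by auto
    then show ?thesis using that assms(4)[of i] by (simp only: i C_closed_form) simp
  next
    case False
    then obtain i where i: "k = 2 * i + 1" by (auto elim: oddE)
    \<comment> \<open>\<open>2 * i + 1\<close> is \<open>2 * Suc i - 1\<close>, so the exponent of 4
      is \<open>i\<close>.\<close>
    show ?thesis using assms(3)[of "Suc i"] by (simp only: i C_closed_form) (simp add: assms(2))
  qed
  have "poly (eulerian_B n) x = ?\<phi> (eulerian_sq n)"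
    by (simp add: eulerian_B_def eulerian_sq_def eval_poly_at_sum poly_sum poly_monom assms(2))
  also have "\<dots> = (\<Sum>T\<in>SYT n. ?\<phi> ((\<Prod>i=1..n. of_int (sigma T i)) * tableau_weight n T))"
    by (simp only: tableau_sum_eq_eulerian_sq[symmetric] tableau_sum_def eval_poly_at_sum)
  also have "\<dots> = (\<Sum>T\<in>SYT n. (\<Prod>i=1..n. of_int (sigma T i) * c i ^ num_rows_of_length i T)
      * sqrt_x ^ (n - length T))"
  proof (rule sum.cong)
    fix T assume T: "T \<in> SYT n"
    \<comment> \<open>Rows of \<open>T\<close> are nonempty, so only indices
      \<open>k \<ge> 1\<close> occur, where \<open>C\<close> and \<open>c\<close> agree.\<close>
    have "prod_list (map (?\<phi> \<circ> (C \<circ> length)) T) = prod_list (map (c \<circ> length) T)"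
      using length_row_SYT[OF T] c by (intro arg_cong[where f = prod_list] map_cong) simp_all
    moreover have "(\<Prod>i=1..n. c i ^ num_rows_of_length i T) = prod_list (map (c \<circ> length) T)"
      using length_row_SYT[OF T] by (intro prod_power_num_rows) auto
    ultimately show "?\<phi> ((\<Prod>i=1..n. of_int (sigma T i)) * tableau_weight n T) =
        (\<Prod>i=1..n. of_int (sigma T i) * c i ^ num_rows_of_length i T) * sqrt_x ^ (n - length T)"
      by (simp add: tableau_weight_def eval_poly_at_prod eval_poly_at_prod_list prod.distrib mult.assoc)
  qed simp
  finally show ?thesis .
qed

end
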